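(* For all integers $n \geq 3$ we have $c(n) \leq 2n-4$, where $c(n)$ denotes the number of length-$n$ factors of the Thue-Morse word $\mathbf{t}$, counted up to cyclic rotation.
   Context: The Thue-Morse word is the infinite binary word $\mathbf{t} = t_0 t_1 t_2 \cdots = 01101001\cdots$, where $t_m$ is the parity of the number of $1$s in the binary representation of $m$. A length-$n$ factor of $\mathbf{t}$ is a word of the form $t_i t_{i+1} \cdots t_{i+n-1}$ for some $i \geq 0$. Two words $x,y$ are cyclically equivalent (equal up to cyclic rotation) if there are words $u,v$ (possibly empty) with $x = uv$ and $y = vu$. For $n \ge 0$, $c(n)$ is the number of cyclic-equivalence classes of words that contain at least one length-$n$ factor of $\mathbf{t}$; i.e., factors of length $n$ that are the same up to cyclic shift are counted once (so $c(0)=1$, $c(1)=2$, $c(2)=3$, $c(3)=2$, $c(4)=4$). *)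

theory Defs
  imports Main
begin

definition thue_morse :: "nat \<Rightarrow> nat" where
  "thue_morse m = card {k. bit m k} mod 2"

definition thue_morse_factors :: "nat \<Rightarrow> nat list set" where
  "thue_morse_factors n = {map thue_morse [i..<i + n] | i. True}"

definition cyclic_equiv :: "('a list \<times> 'a list) set" where
  "cyclic_equiv = {(x, y). \<exists>u v. x = u @ v \<and> y = v @ u}"

lemma cyclic_equiv_iff_rotate: "(x, y) \<in> cyclic_equiv \<longleftrightarrow> (\<exists>k. y = rotate k x)"
proof
  assume "(x, y) \<in> cyclic_equiv"
  then obtain u v where "x = u @ v" "y = v @ u"
    by (auto simp: cyclic_equiv_def)
  then show "\<exists>k. y = rotate k x"
    by (metis rotate_append)
next
  assume "\<exists>k. y = rotate k x"
  then obtain k where "y = rotate k x" ..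
  then have "x = take (k mod length x) x @ drop (k mod length x) x"
    and "y = drop (k mod length x) x @ take (k mod length x) x"
    by (simp_all add: rotate_drop_take)
  then show "(x, y) \<in> cyclic_equiv"
    unfolding cyclic_equiv_def by blast
qed

lemma equiv_cyclic_equiv: "equiv UNIV cyclic_equiv"
proof (rule equivI)
  show "cyclic_equiv \<subseteq> UNIV \<times> UNIV" by simp
  show "refl cyclic_equiv"
    by (auto simp: refl_on_def cyclic_equiv_def)
  show "sym cyclic_equiv"
    by (auto simp: sym_def cyclic_equiv_def)
  show "trans cyclic_equiv"
    by (auto simp: trans_def cyclic_equiv_iff_rotate rotate_rotate)
qed

text \<open>The relation lives on all words, so the elements of the quotient below are full
  cyclic classes, which may also contain words that are not factors.\<close>

definition cyclic_complexity :: "nat \<Rightarrow> nat" where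
  "cyclic_complexity n = card (thue_morse_factors n // cyclic_equiv)"

lemma finite_thue_morse_factors: "finite (thue_morse_factors n)"
proof (rule finite_subset)
  show "thue_morse_factors n \<subseteq> {xs. set xs \<subseteq> {0, 1} \<and> length xs = n}"
    by (auto simp: thue_morse_factors_def thue_morse_def)
  show "finite {xs :: nat list. set xs \<subseteq> {0, 1} \<and> length xs = n}"
    by (rule finite_lists_length_eq) simp
qed

text \<open>Hence \<^const>\<open>cyclic_complexity\<close> counts a finite set and never takes the default value
  of \<^const>\<open>card\<close>.\<close>

lemma finite_cyclic_classes: "finite (thue_morse_factors n // cyclic_equiv)"
  unfolding quotient_def using finite_thue_morse_factors by simp

end

theory Submission
  imports Defs
begin

text \<open>
  Write \<open>\<mu>\<close> for the morphism \<open>0 \<mapsto> 01, 1 \<mapsto> 10\<close>, which fixes the Thue-Morse word, and \<open>a'\<close> for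
  the complement of a letter. A factor of length \<open>2m\<close> is \<open>\<mu>(x)\<close> or \<open>a' \<mu>(x) b\<close> with factors \<open>x\<close>,
  \<open>axb\<close>. If \<open>a = b\<close> then \<open>a' \<mu>(x) a\<close> is a rotation of \<open>\<mu>(ax)\<close>, so \<open>c(2m) \<le> c(m) + D(m + 1)\<close>, where
  \<open>D(k)\<close> and \<open>E(k)\<close> count the factors of length \<open>k\<close> with distinct and with equal end letters.

  A factor of odd length is a rotation of \<open>b \<mu>(x)\<close> where \<open>b'x\<close> or \<open>xb\<close> is a factor. Desubstituting
  these a second time, and using that \<open>b \<mu>(b'u)\<close> is a rotation of \<open>b \<mu>(ub)\<close>, identifies enough
  classes to give \<open>c(4m + 1) \<le> P(m) + E(m + 1)\<close> and
  \<open>c(4m + 3) \<le> E(m + 2) + D(m + 1) + (D(m + 1) + E(m + 1))\<close>, where \<open>P(m)\<close> counts the pairs \<open>(y, l)\<close>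
  with \<open>|y| = m\<close> such that \<open>ly\<close> or \<open>yl\<close> is a factor. Desubstitution also yields recurrences that
  prove \<open>D(k), E(k) \<le> 2(k - 1)\<close> and \<open>P(m) \<le> 6m - 2\<close>, and these bounds fit with nothing to spare.
\<close>

section \<open>The Thue-Morse word under doubling of positions\<close>

definition tm :: "nat \<Rightarrow> bool" where
  "tm i = odd (card {k. bit i k})"

lemma finite_bits: "finite {k. bit (n::nat) k}"
proof (rule finite_subset)
  show "{k. bit n k} \<subseteq> {..n}"
  proof
    fix k assume "k \<in> {k. bit n k}"
    then have "n div 2 ^ k \<noteq> 0" by (auto simp: bit_iff_odd intro!: Nat.gr0I)
    then have "2 ^ k \<le> n" by (metis div_less not_le)
    then show "k \<in> {..n}" using less_exp[of k] by (simp only: atMost_iff)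
  qed
qed simp

text \<open>Letters become booleans so that complementing a letter is negation;
  \<open>of_bool\<close> translates back.\<close>

lemma thue_morse_eq_tm: "thue_morse i = of_bool (tm i)"
  by (simp add: thue_morse_def tm_def mod_2_eq_odd)

text \<open>Appending the binary digit 0 only shifts the other digits. In the next lemma the
  appended digit 1 flips the parity.\<close>

lemma tm_double: "tm (2 * i) = tm i"
proof -
  have "{k. bit (2 * i) k} = Suc ` {k. bit i k}"
    by (auto simp: bit_double_iff image_iff gr0_conv_Suc Suc_le_eq)
  then show ?thesis by (simp add: tm_def card_image)
qed

lemma tm_double_Suc: "tm (Suc (2 * i)) = (\<not> tm i)"
proof -
  have "bit (Suc (2 * i)) k \<longleftrightarrow> k = 0 \<or> (\<exists>l. k = Suc l \<and> bit i l)" for k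
    by (cases k) (simp_all add: bit_0 bit_Suc)
  then have "{k. bit (Suc (2 * i)) k} = insert 0 (Suc ` {k. bit i k})"
    by auto
  then show ?thesis by (simp add: tm_def card_image finite_bits)
qed

section \<open>The morphism and desubstitution of factors\<close>

fun mu :: "bool list \<Rightarrow> bool list" where
  "mu [] = []"
| "mu (a # w) = a # (\<not> a) # mu w"

lemma mu_append [simp]: "mu (u @ v) = mu u @ mu v"
  by (induction u) auto

lemma mu_eq_Nil_iff [simp]: "mu w = [] \<longleftrightarrow> w = []"
  by (cases w) auto

lemma last_mu [simp]: "w \<noteq> [] \<Longrightarrow> last (mu w) = (\<not> last w)"
  by (induction w) auto

lemma hd_mu [simp]: "w \<noteq> [] \<Longrightarrow> hd (mu w) = hd w"
  by (cases w) auto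

definition factors :: "nat \<Rightarrow> bool list set" where
  "factors n = {map tm [i..<i + n] | i. True}"

lemma factorsI: "map tm [i..<i + n] \<in> factors n"
  unfolding factors_def by blast

lemma length_factors: "w \<in> factors n \<Longrightarrow> length w = n"
  by (auto simp: factors_def)

lemma finite_factors [simp]: "finite (factors n)"
proof (rule finite_subset)
  show "factors n \<subseteq> {w. set w \<subseteq> UNIV \<and> length w = n}"
    by (auto simp: length_factors)
qed (rule finite_lists_length_eq, simp)

lemma factors_ConsD: "a # w \<in> factors (Suc n) \<Longrightarrow> w \<in> factors n"
proof -
  assume "a # w \<in> factors (Suc n)"
  then obtain i where "a # w = map tm [i..<i + Suc n]"
    unfolding factors_def by (elim CollectE exE conjE)
  then have "w = map tm [Suc i..<Suc i + n]"
    by (simp add: upt_conv_Cons del: upt_Suc)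
  then show "w \<in> factors n" by (simp only: factorsI)
qed

lemma factors_snocD: "w @ [a] \<in> factors (Suc n) \<Longrightarrow> w \<in> factors n"
  by (auto simp: factors_def)

lemma mu_map_tm: "mu (map tm [i..<i + n]) = map tm [2 * i..<2 * i + 2 * n]"
proof (induction n)
  case (Suc n)
  have "tm (2 * i + 2 * n) = tm (i + n)" "tm (Suc (2 * i + 2 * n)) = (\<not> tm (i + n))"
    using tm_double[of "i + n"] tm_double_Suc[of "i + n"] by simp_all
  then show ?case using Suc by simp
qed simp

text \<open>The parity of the start decides. From an odd position the factor begins with the second
  letter of the image of \<open>a\<close> and stops after the first letter of the image of
  \<open>b\<close>.\<close>

lemma factors_even_cases:
  assumes "w \<in> factors (2 * m)" "m \<ge> 1"
  obtains (even) "x" where "x \<in> factors m" "w = mu x"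
    | (odd) a x b where "a # x @ [b] \<in> factors (Suc m)" "w = (\<not> a) # mu x @ [b]"
proof -
  obtain i where w: "w = map tm [i..<i + 2 * m]"
    using assms(1) by (auto simp: factors_def)
  show thesis
  proof (cases "even i")
    case True
    then obtain q where "i = 2 * q" by auto
    then show thesis using w mu_map_tm[of q m] even[of "map tm [q..<q + m]"] by (auto simp: factors_def)
  next
    case False
    then obtain q where i: "i = Suc (2 * q)" using oddE by fastforce
    obtain l where m: "m = Suc l" using assms(2) by (cases m) auto
    define x where "x = map tm [Suc q..<Suc q + l]"
    have "[q..<q + Suc m] = q # [Suc q..<Suc q + l] @ [Suc q + l]"
      using m upt_conv_Cons[of q "Suc (q + l)"] by simp
    then have "tm q # x @ [tm (Suc q + l)] = map tm [q..<q + Suc m]"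
      by (simp only: x_def list.map map_append)
    then have f: "tm q # x @ [tm (Suc q + l)] \<in> factors (Suc m)"
      by (simp only: factorsI)
    have "[i..<i + 2 * m] = Suc (2 * q) # [2 * Suc q..<2 * Suc q + 2 * l] @ [2 * (Suc q + l)]"
      using i m by (simp add: upt_conv_Cons)
    then have "w = (\<not> tm q) # mu x @ [tm (Suc q + l)]"
      unfolding w x_def mu_map_tm using tm_double[of "Suc q + l"] tm_double_Suc[of q] by simp
    with f show thesis by (rule odd)
  qed
qed

text \<open>An odd length cuts exactly one image of a letter: the last after an even start, the
  first after an odd start.\<close>

lemma factors_odd_cases:
  assumes "w \<in> factors (Suc (2 * m))"
  obtains (even) x b where "x @ [b] \<in> factors (Suc m)" "w = mu x @ [b]"
    | (odd) a x where "a # x \<in> factors (Suc m)" "w = (\<not> a) # mu x"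
proof -
  obtain i where w: "w = map tm [i..<i + Suc (2 * m)]"
    using assms(1) by (auto simp: factors_def)
  show thesis
  proof (cases "even i")
    case True
    then obtain q where i: "i = 2 * q" by auto
    have f: "map tm [q..<q + m] @ [tm (q + m)] \<in> factors (Suc m)"
      unfolding factors_def by (auto intro!: exI[of _ q])
    have "w = mu (map tm [q..<q + m]) @ [tm (q + m)]"
      unfolding w mu_map_tm using i tm_double[of "q + m"] by simp
    with f show thesis by (rule even)
  next
    case False
    then obtain q where i: "i = Suc (2 * q)" using oddE by fastforce
    have f: "tm q # map tm [Suc q..<Suc q + m] \<in> factors (Suc m)"
      unfolding factors_def by (auto intro!: exI[of _ q] simp: upt_conv_Cons simp del: upt_Suc)
    have "w = (\<not> tm q) # mu (map tm [Suc q..<Suc q + m])"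
      unfolding w mu_map_tm using i tm_double_Suc[of q] by (simp add: upt_conv_Cons del: upt_Suc)
    with f show thesis by (rule odd)
  qed
qed

text \<open>Two of any three consecutive positions carry the image of a single letter, whose two
  letters differ.\<close>

lemma no_cube: "[a, a, a] \<notin> factors 3"
proof
  assume "[a, a, a] \<in> factors 3"
  then have "[a, a, a] \<in> factors (Suc (2 * 1))" by (simp add: numeral_3_eq_3)
  then show False
  proof (cases rule: factors_odd_cases)
    case (even x b) then show False by (cases x rule: mu.cases) auto
  next
    case (odd c x) then show False by (cases x rule: mu.cases) auto
  qed
qed

section \<open>Factors with equal and with distinct end letters (\<open>E\<close> and
  \<open>D\<close>)\<close>

definition ends :: "bool \<Rightarrow> nat \<Rightarrow> bool list set" where
  "ends s n = {w \<in> factors n. (hd w = last w) = s}"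

lemma finite_ends [simp]: "finite (ends s n)"
  by (simp add: ends_def)

lemma card_factors: "card (factors n) = card (ends False n) + card (ends True n)"
proof -
  have "factors n = ends False n \<union> ends True n" and "ends False n \<inter> ends True n = {}"
    by (auto simp: ends_def)
  then show ?thesis by (metis card_Un_disjoint finite_ends)
qed

lemma card_le_two_images:
  assumes "S \<subseteq> f ` A \<union> g ` B" "finite A" "finite B"
  shows "card S \<le> card A + card B"
proof -
  have "card S \<le> card (f ` A \<union> g ` B)" using assms by (intro card_mono) auto
  also have "\<dots> \<le> card (f ` A) + card (g ` B)" by (rule card_Un_le)
  also have "\<dots> \<le> card A + card B" using assms by (intro add_mono card_image_le)
  finally show ?thesis .
qed

lemma card_le_three_images:
  assumes "S \<subseteq> f ` A \<union> g ` B \<union> h ` C" "finite A" "finite B" "finite C"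
  shows "card S \<le> card A + card B + card C"
proof -
  have "card S \<le> card (f ` A \<union> g ` B) + card C"
    using assms by (intro card_le_two_images[where f = id and g = h]) auto
  also have "card (f ` A \<union> g ` B) \<le> card A + card B"
    using assms by (intro card_le_two_images[where f = f and g = g]) auto
  finally show ?thesis by simp
qed

lemma card_le_four_images:
  assumes "S \<subseteq> f ` A \<union> g ` B \<union> h ` C \<union> k ` D" "finite A" "finite B" "finite C" "finite D"
  shows "card S \<le> card A + card B + card C + card D"
proof -
  have "card S \<le> card (f ` A \<union> g ` B \<union> h ` C) + card D"
    using assms by (intro card_le_two_images[where f = id and g = k]) auto
  also have "card (f ` A \<union> g ` B \<union> h ` C) \<le> card A + card B + card C"
    using assms by (intro card_le_three_images[where f = f and g = g and h = h]) auto
  finally show ?thesis by simp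
qed

lemma butlast_mu_snoc: "butlast (mu (x @ [b])) = mu x @ [b]"
  and trim_mu: "tl (butlast (mu (a # x @ [b]))) = (\<not> a) # mu x @ [b]"
  by (simp_all add: butlast_append)

text \<open>In both shapes exactly one end letter is complemented, the last in \<open>mu x\<close>
  and the first in \<open>(\<not> a) # mu x @ [b]\<close>, so \<open>s\<close> turns into
  \<open>\<not> s\<close>.\<close>

lemma card_ends_even:
  assumes "m \<ge> 1"
  shows "card (ends s (2 * m)) \<le> card (ends (\<not> s) m) + card (ends (\<not> s) (Suc m))"
proof (rule card_le_two_images)
  let ?R = "mu ` ends (\<not> s) m \<union> (\<lambda>w. tl (butlast (mu w))) ` ends (\<not> s) (Suc m)"
  show "ends s (2 * m) \<subseteq> ?R"
  proof
    fix w assume "w \<in> ends s (2 * m)"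
    then have w: "w \<in> factors (2 * m)" "(hd w = last w) = s" by (auto simp: ends_def)
    from w(1) assms show "w \<in> ?R"
    proof (cases rule: factors_even_cases)
      case (even x)
      then have "x \<noteq> []" using assms length_factors by fastforce
      then show ?thesis using even w(2) by (auto simp: ends_def)
    next
      case (odd a x b)
      then show ?thesis using w(2)
        by (intro UnI2 image_eqI[of _ _ "a # x @ [b]"]) (auto simp: ends_def trim_mu simp del: mu.simps)
    qed
  qed
qed auto

text \<open>In \<open>mu x @ [b]\<close> neither end letter is complemented, in
  \<open>(\<not> a) # mu x\<close> both are, so agreement of the ends is preserved.\<close>

lemma card_ends_odd:
  assumes "m \<ge> 1"
  shows "card (ends s (Suc (2 * m))) \<le> card (ends s (Suc m)) + card (ends s (Suc m))"
proof (rule card_le_two_images)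
  let ?R = "(\<lambda>w. butlast (mu w)) ` ends s (Suc m) \<union> (\<lambda>w. tl (mu w)) ` ends s (Suc m)"
  show "ends s (Suc (2 * m)) \<subseteq> ?R"
  proof
    fix w assume "w \<in> ends s (Suc (2 * m))"
    then have w: "w \<in> factors (Suc (2 * m))" "(hd w = last w) = s" by (auto simp: ends_def)
    from w(1) show "w \<in> ?R"
    proof (cases rule: factors_odd_cases)
      case (even x b)
      then have "x \<noteq> []" using assms length_factors by fastforce
      then show ?thesis using even w(2)
        by (intro UnI1 image_eqI[of _ _ "x @ [b]"]) (auto simp: ends_def butlast_mu_snoc simp del: mu_append)
    next
      case (odd a x)
      then have "x \<noteq> []" using assms length_factors by fastforce
      then show ?thesis using odd w(2)
        by (intro UnI2 image_eqI[of _ _ "a # x"]) (auto simp: ends_def)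
    qed
  qed
qed auto

lemma length_2_conv: "length w = 2 \<longleftrightarrow> (\<exists>a b. w = [a, b])"
  and length_3_conv: "length w = 3 \<longleftrightarrow> (\<exists>a b c. w = [a, b, c])"
  and length_4_conv: "length w = 4 \<longleftrightarrow> (\<exists>a b c d. w = [a, b, c, d])"
  by (auto simp: numeral_eq_Suc length_Suc_conv)

lemma card_ends_2: "card (ends s 2) \<le> 2"
proof -
  let ?L = "[[False, False = s], [True, True = s]]"
  have "ends s 2 \<subseteq> set ?L"
    by (auto simp: ends_def length_2_conv dest!: length_factors)
  then have "card (ends s 2) \<le> card (set ?L)"
    by (intro card_mono) auto
  also have "\<dots> \<le> length ?L" by (rule card_length)
  finally show ?thesis by simp
qed

lemma card_ends_3: "card (ends s 3) \<le> 4"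
proof -
  let ?L = "[[False, False, False = s], [True, False, True = s],
             [False, True, False = s], [True, True, True = s]]"
  have "ends s 3 \<subseteq> set ?L"
    by (auto simp: ends_def length_3_conv dest!: length_factors)
  then have "card (ends s 3) \<le> card (set ?L)"
    by (intro card_mono) auto
  also have "\<dots> \<le> length ?L" by (rule card_length)
  finally show ?thesis by simp
qed

lemma card_ends_le: "n \<ge> 2 \<Longrightarrow> card (ends s n) \<le> 2 * (n - 1)"
proof (induction n arbitrary: s rule: less_induct)
  case (less n)
  \<comment> \<open>For \<open>n = 2\<close> the recurrence would refer back to
    \<open>Suc m = 2\<close>, so this length is counted directly. For \<open>m \<ge> 2\<close> both
    \<open>m\<close> and \<open>Suc m\<close> lie below \<open>n\<close> and are at least 2.\<close>
  have "n = 2 \<or> n = 3 \<or> (\<exists>m\<ge>2. n = 2 * m) \<or> (\<exists>m\<ge>2. n = Suc (2 * m))"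
    using less.prems by presburger
  then consider "n = 2" | "n = 3" | m where "n = 2 * m" "m \<ge> 2" | m where "n = Suc (2 * m)" "m \<ge> 2"
    by blast
  then show ?case
  proof cases
    case 1 then show ?thesis using card_ends_2 by simp
  next
    case 2 then show ?thesis using card_ends_3 by simp
  next
    case (3 m)
    then show ?thesis
      using less.IH[of m "\<not> s"] less.IH[of "Suc m" "\<not> s"] card_ends_even[of m s] by auto
  next
    case (4 m)
    then show ?thesis
      using less.IH[of "Suc m" s] card_ends_odd[of m s] by auto
  qed
qed

lemma card_factors_le: "n \<ge> 2 \<Longrightarrow> card (factors n) \<le> 4 * (n - 1)"
  using card_ends_le[of n True] card_ends_le[of n False] by (simp add: card_factors)

section \<open>Words with a one-letter extension (\<open>P\<close>)\<close>

text \<open>The letter \<open>l = s\<close> is \<open>l\<close> for \<open>s = True\<close> and its complement for \<open>s = False\<close>. The complemented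
  variant is needed because \<open>\<mu>\<close> complements left extensions, so the two cases alternate in the
  recurrences.\<close>

definition ext :: "bool \<Rightarrow> nat \<Rightarrow> (bool list \<times> bool) set" where
  "ext s n = {(y, l). (l = s) # y \<in> factors (Suc n) \<or> y @ [l] \<in> factors (Suc n)}"

lemma finite_ext [simp]: "finite (ext s n)"
proof (rule finite_subset)
  show "ext s n \<subseteq> factors n \<times> UNIV"
    by (auto simp: ext_def dest: factors_ConsD factors_snocD)
qed simp

lemma ext_cases:
  assumes "p \<in> ext s n"
  obtains (left) y l where "p = (y, l)" "(l = s) # y \<in> factors (Suc n)"
    | (right) y l where "p = (y, l)" "y @ [l] \<in> factors (Suc n)"
  using assms by (auto simp: ext_def)

lemma factors_Cons_conv_snoc: "a # x \<in> factors (Suc m) \<Longrightarrow> m \<ge> 1 \<Longrightarrow> \<exists>x' c. x = x' @ [c]"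
  using length_factors[of "a # x" "Suc m"] by (cases x rule: rev_cases) auto

lemma factors_snoc_conv_Cons: "x @ [b] \<in> factors (Suc m) \<Longrightarrow> m \<ge> 1 \<Longrightarrow> \<exists>x' c. x = c # x'"
  using length_factors[of "x @ [b]" "Suc m"] by (cases x) auto

text \<open>If \<open>y = mu x\<close>, then \<open>l\<close> extends \<open>x\<close>. Otherwise
  \<open>y\<close> is \<open>(\<not> a) # mu x @ [b]\<close>, and completing a cut image forces
  \<open>a = (l = s)\<close> on the left or \<open>l = (\<not> b)\<close> on the right. The first
  value of \<open>l\<close> is charged to all factors \<open>a # x @ [b]\<close>; the second differs
  from it only if \<open>(a = b) = s\<close>.\<close>

lemma card_ext_even:
  assumes "m \<ge> 1"
  shows "card (ext s (2 * m)) \<le> card (ext (\<not> s) m) + card (factors (Suc m)) + card (ends s (Suc m))"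
proof (rule card_le_three_images)
  let ?A = "(\<lambda>(x, l). (mu x, l)) ` ext (\<not> s) m"
  let ?B = "(\<lambda>w. (tl (butlast (mu w)), hd w = s)) ` factors (Suc m)"
  let ?C = "(\<lambda>w. (tl (butlast (mu w)), hd w \<noteq> s)) ` ends s (Suc m)"
  have B: "((\<not> a) # mu x @ [b], l) \<in> ?B \<union> ?C"
    if "a # x @ [b] \<in> factors (Suc m)" "a = (l = s) \<or> l = (\<not> b)" for a x b l
  proof (cases "a = (l = s)")
    case True
    then show ?thesis using that
      by (intro UnI1 image_eqI[of _ _ "a # x @ [b]"]) (auto simp: trim_mu simp del: mu.simps)
  next
    case False
    then show ?thesis using that
      by (intro UnI2 image_eqI[of _ _ "a # x @ [b]"]) (auto simp: trim_mu ends_def simp del: mu.simps)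
  qed
  show "ext s (2 * m) \<subseteq> ?A \<union> ?B \<union> ?C"
  proof
    fix p assume "p \<in> ext s (2 * m)"
    then show "p \<in> ?A \<union> ?B \<union> ?C"
    proof (cases rule: ext_cases)
      case (left y l)
      from left(2) show ?thesis
      proof (cases rule: factors_odd_cases)
        case (even x b)
        then obtain x' c where "x = c # x'" using assms factors_snoc_conv_Cons by blast
        then show ?thesis using B[of c x' b l] even left by auto
      next
        case (odd a x)
        then have "a = (l = (\<not> s))" and "y = mu x" by auto
        with odd(1) have "(x, l) \<in> ext (\<not> s) m" by (simp add: ext_def)
        then show ?thesis using \<open>y = mu x\<close> left(1) by force
      qed
    next
      case (right y l)
      from right(2) show ?thesis
      proof (cases rule: factors_odd_cases)
        case (even x b)
        then have "(x, l) \<in> ext (\<not> s) m" by (auto simp: ext_def)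
        then show ?thesis using even right(1) by force
      next
        case (odd a x)
        then obtain x' c where x: "x = x' @ [c]" using assms factors_Cons_conv_snoc by blast
        then have "y @ [l] = ((\<not> a) # mu x' @ [c]) @ [\<not> c]" using odd by simp
        then show ?thesis using B[of a x' c l] odd right(1) x by (simp only: append1_eq_conv) simp
      qed
    qed
  qed
qed auto

text \<open>Here \<open>y\<close> is \<open>(\<not> a) # mu x\<close> or \<open>mu x @ [c]\<close>.
  On the side of the cut image \<open>l\<close> is forced, giving one pair per factor of length
  \<open>Suc m\<close>. On the other side the desubstituted factor gains a letter; if
  \<open>l\<close> is not the forced one, this longer factor lies in
  \<open>ends (\<not> s) (Suc (Suc m))\<close>.\<close>

lemma card_ext_odd:
  "card (ext s (Suc (2 * m))) \<le> card (factors (Suc m)) + card (ends (\<not> s) (Suc (Suc m))) +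
     card (factors (Suc m)) + card (ends (\<not> s) (Suc (Suc m)))"
proof (rule card_le_four_images)
  let ?A = "(\<lambda>w. (tl (mu w), hd w = s)) ` factors (Suc m)"
  let ?B = "(\<lambda>w. (tl (mu (butlast w)), last w)) ` ends (\<not> s) (Suc (Suc m))"
  let ?C = "(\<lambda>w. (butlast (mu w), \<not> last w)) ` factors (Suc m)"
  let ?D = "(\<lambda>w. (butlast (mu (tl w)), last w)) ` ends (\<not> s) (Suc (Suc m))"
  have L: "((\<not> a) # mu x, l) \<in> ?A \<union> ?B"
    if "a # x \<in> factors (Suc m)" "a = (l = s) \<or> a # x @ [l] \<in> factors (Suc (Suc m))" for a x l
  proof (cases "a = (l = s)")
    case True
    then show ?thesis using that by (intro UnI1 image_eqI[of _ _ "a # x"]) auto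
  next
    case False
    then show ?thesis using that
      by (intro UnI2 image_eqI[of _ _ "a # x @ [l]"]) (auto simp: ends_def butlast_append)
  qed
  have R: "(mu x @ [c], l) \<in> ?C \<union> ?D"
    if "x @ [c] \<in> factors (Suc m)" "l = (\<not> c) \<or> (l \<noteq> s) # x @ [c] \<in> factors (Suc (Suc m))" for x c l
  proof (cases "l = (\<not> c)")
    case True
    then show ?thesis using that
      by (intro UnI1 image_eqI[of _ _ "x @ [c]"]) (auto simp: butlast_mu_snoc simp del: mu_append)
  next
    case False
    then show ?thesis using that
      by (intro UnI2 image_eqI[of _ _ "(l \<noteq> s) # x @ [c]"])
        (auto simp: ends_def butlast_mu_snoc simp del: mu_append)
  qed
  show "ext s (Suc (2 * m)) \<subseteq> ?A \<union> ?B \<union> ?C \<union> ?D"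
  proof
    fix p assume "p \<in> ext s (Suc (2 * m))"
    then show "p \<in> ?A \<union> ?B \<union> ?C \<union> ?D"
    proof (cases rule: ext_cases)
      case (left y l)
      then have "(l = s) # y \<in> factors (2 * Suc m)" "Suc m \<ge> 1" by simp_all
      then show ?thesis
      proof (cases rule: factors_even_cases)
        case (even x)
        then obtain c x' where "x = c # x'" by (cases x) auto
        then show ?thesis using L[of c x' l] even left(1) by auto
      next
        case (odd a x b)
        then have "x @ [b] \<in> factors (Suc m)" by (blast dest: factors_ConsD)
        moreover have "a = (l \<noteq> s)" "y = mu x @ [b]" using odd(2) by auto
        ultimately show ?thesis using R[of x b l] odd(1) left(1) by simp
      qed
    next
      case (right y l)
      then have "y @ [l] \<in> factors (2 * Suc m)" "Suc m \<ge> 1" by simp_all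
      then show ?thesis
      proof (cases rule: factors_even_cases)
        case (even x)
        then obtain c x' where x: "x = x' @ [c]" by (cases x rule: rev_cases) auto
        then have "y @ [l] = (mu x' @ [c]) @ [\<not> c]" using even by simp
        then show ?thesis using R[of x' c l] even right(1) x by (simp only: append1_eq_conv) simp
      next
        case (odd a x b)
        then have "a # x \<in> factors (Suc m)" using factors_snocD[of "a # x" b "Suc m"] by simp
        moreover have "y @ [l] = ((\<not> a) # mu x) @ [b]" using odd by simp
        ultimately show ?thesis using L[of a x l] odd right(1) by (simp only: append1_eq_conv) simp
      qed
    qed
  qed
qed auto

lemma card_ext_le: "n \<ge> 1 \<Longrightarrow> card (ext s n) \<le> 6 * n - 2"
proof (induction n arbitrary: s rule: less_induct)
  case (less n)
  \<comment> \<open>The sums are exactly \<open>(6 * m - 2) + 4 * m + 2 * m\<close> and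
    \<open>2 * (4 * m + 2 * (m + 1))\<close>. Length 1 is separate because
    \<open>card_factors_le\<close> starts at length 2.\<close>
  have "n = 1 \<or> (\<exists>m\<ge>1. n = 2 * m) \<or> (\<exists>m\<ge>1. n = Suc (2 * m))"
    using less.prems by presburger
  then consider "n = 1" | m where "n = 2 * m" "m \<ge> 1" | m where "n = Suc (2 * m)" "m \<ge> 1"
    by blast
  then show ?case
  proof cases
    case 1
    let ?L = "[([False], False), ([False], True), ([True], False), ([True], True)]"
    have "ext s 1 \<subseteq> set ?L"
      by (auto simp: ext_def length_Suc_conv dest!: length_factors)
    then have "card (ext s 1) \<le> card (set ?L)"
      by (intro card_mono) auto
    also have "\<dots> \<le> length ?L" by (rule card_length)
    finally show ?thesis using 1 by simp
  next
    case (2 m)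
    then show ?thesis
      using less.IH[of m "\<not> s"] card_ext_even[of m s] card_factors_le[of "Suc m"]
        card_ends_le[of "Suc m" s] by simp
  next
    case (3 m)
    then show ?thesis
      using card_ext_odd[of s m] card_factors_le[of "Suc m"]
        card_ends_le[of "Suc (Suc m)" "\<not> s"] by simp
  qed
qed

section \<open>Cyclic classes and morphisms\<close>

definition cls :: "'a list \<Rightarrow> 'a list set" where
  "cls w = cyclic_equiv `` {w}"

lemma cls_append: "cls (u @ v) = cls (v @ u)"
  unfolding cls_def
  by (rule equiv_class_eq[OF equiv_cyclic_equiv]) (auto simp: cyclic_equiv_def)

lemma cls_Cons: "cls (a # u) = cls (u @ [a])"
  using cls_append[of "[a]" u] by simp

text \<open>A map that respects concatenation sends rotations to rotations, so saturating the image
  of a class gives a well-defined map on classes. It serves for \<open>mu\<close> and for the coding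
  of letters by numbers.\<close>

lemma cls_image:
  assumes "\<And>u v. h (u @ v) = h u @ h v"
  shows "cyclic_equiv `` (h ` cls w) = cls (h w)"
proof -
  have "cls (h x) = cls (h w)" if "x \<in> cls w" for x
  proof -
    obtain u v where "w = u @ v" "x = v @ u"
      using \<open>x \<in> cls w\<close> by (auto simp: cls_def cyclic_equiv_def)
    then show ?thesis using assms cls_append[of "h u" "h v"] by simp
  qed
  moreover have "w \<in> cls w"
    by (auto simp: cls_def cyclic_equiv_def)
  ultimately have "(\<Union>x\<in>cls w. cls (h x)) = cls (h w)" by blast
  moreover have "cyclic_equiv `` S = (\<Union>x\<in>S. cls x)" for S :: "'b list set"
    by (auto simp: cls_def)
  ultimately show ?thesis by simp
qed

definition classes :: "nat \<Rightarrow> bool list set set" where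
  "classes n = cls ` factors n"

lemma finite_classes [simp]: "finite (classes n)"
  by (simp add: classes_def)

lemma cyclic_complexity_le: "cyclic_complexity n \<le> card (classes n)"
proof -
  have "thue_morse = (\<lambda>i. of_bool (tm i))"
    using thue_morse_eq_tm by blast
  then have "map thue_morse [i..<i + n] = map of_bool (map tm [i..<i + n])" for i
    by (simp add: comp_def)
  then have "thue_morse_factors n = map of_bool ` factors n"
    by (auto simp: thue_morse_factors_def factors_def simp del: map_map)
  then have "thue_morse_factors n // cyclic_equiv = (\<lambda>w. cls (map of_bool w)) ` factors n"
    by (auto simp: quotient_def cls_def)
  also have "\<dots> = (\<lambda>C. cyclic_equiv `` (map of_bool ` C)) ` classes n"
    by (simp add: classes_def image_image cls_image)
  finally show ?thesis
    by (simp add: cyclic_complexity_def card_image_le)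
qed

text \<open>The word on the left regroups as \<open>mu [b] @ b # mu u\<close>, and
  \<open>mu [b]\<close> rotates to the end. Thus below \<open>b # mu _\<close> a leading
  \<open>\<not> b\<close> can be traded for a trailing \<open>b\<close>.\<close>

lemma cls_mu_shift: "cls (b # mu ((\<not> b) # u)) = cls (b # mu (u @ [b]))"
  using cls_append[of "mu [b]" "b # mu u"] by simp

section \<open>Recurrences for the number of classes\<close>

lemma card_classes_even:
  assumes "m \<ge> 1"
  shows "card (classes (2 * m)) \<le> card (classes m) + card (ends False (Suc m))"
proof (rule card_le_two_images)
  let ?A = "(\<lambda>C. cyclic_equiv `` (mu ` C)) ` classes m"
  let ?B = "(\<lambda>w. cls (tl (butlast (mu w)))) ` ends False (Suc m)"
  have A: "cls (mu x) \<in> ?A" if "x \<in> factors m" for x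
    using that by (simp add: classes_def image_image cls_image)
  show "classes (2 * m) \<subseteq> ?A \<union> ?B"
  proof
    fix C assume "C \<in> classes (2 * m)"
    then obtain w where C: "C = cls w" and w: "w \<in> factors (2 * m)"
      by (auto simp: classes_def)
    from w assms show "C \<in> ?A \<union> ?B"
    proof (cases rule: factors_even_cases)
      case (even x)
      then show ?thesis using A C by simp
    next
      case (odd a x b)
      show ?thesis
      proof (cases "a = b")
        case True
        then have "C = cls (mu (b # x))"
          using odd C cls_append[of "(\<not> a) # mu x" "[b]"] by simp
        moreover have "b # x \<in> factors m"
          using odd True factors_snocD[of "a # x" b m] by simp
        ultimately show ?thesis using A by blast
      next
        case False
        then show ?thesis using odd C
          by (intro UnI2 image_eqI[of _ _ "a # x @ [b]"]) (auto simp: trim_mu ends_def simp del: mu.simps)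
      qed
    qed
  qed
qed auto

lemma classes_odd_cases:
  assumes "C \<in> classes (Suc (2 * m))"
  obtains (left) b x where "C = cls (b # mu x)" "(\<not> b) # x \<in> factors (Suc m)"
    | (right) b x where "C = cls (b # mu x)" "x @ [b] \<in> factors (Suc m)"
proof -
  obtain w where C: "C = cls w" and w: "w \<in> factors (Suc (2 * m))"
    using assms by (auto simp: classes_def)
  from w show thesis
  proof (cases rule: factors_odd_cases)
    case (even x b)
    then show thesis using C right[of b x] by (simp add: cls_Cons)
  next
    case (odd a x)
    then show thesis using C left[of "\<not> a" x] by simp
  qed
qed

text \<open>In \<open>b # mu x\<close> either \<open>x = mu y\<close>, which \<open>ext\<close>
  counts, or both ends of \<open>x\<close> are cut images. Then \<open>cls_mu_shift\<close> realigns
  \<open>x\<close>, unless \<open>x = b # mu g @ [\<not> b]\<close>, which comes from the factor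
  \<open>(\<not> b) # g @ [\<not> b]\<close> with equal ends.\<close>

lemma card_classes_4_1:
  assumes "m \<ge> 1"
  shows "card (classes (Suc (2 * (2 * m)))) \<le> card (ext True m) + card (ends True (Suc m))"
proof (rule card_le_two_images)
  let ?A = "(\<lambda>(y, l). cls (l # mu (mu y))) ` ext True m"
  let ?B = "(\<lambda>w. cls ((\<not> hd w) # mu (tl (butlast (mu w))))) ` ends True (Suc m)"
  have A: "cls (l # mu (mu y)) \<in> ?A" if "l # y \<in> factors (Suc m) \<or> y @ [l] \<in> factors (Suc m)" for y l
    using that by (intro image_eqI[of _ _ "(y, l)"]) (auto simp: ext_def)
  have B: "cls (b # mu (b # mu x @ [\<not> b])) \<in> ?B" if "(\<not> b) # x @ [\<not> b] \<in> factors (Suc m)" for x b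
    using that by (intro image_eqI[of _ _ "(\<not> b) # x @ [\<not> b]"])
      (auto simp: ends_def trim_mu simp del: mu.simps(2))
  show "classes (Suc (2 * (2 * m))) \<subseteq> ?A \<union> ?B"
  proof
    fix C assume "C \<in> classes (Suc (2 * (2 * m)))"
    then show "C \<in> ?A \<union> ?B"
    proof (cases rule: classes_odd_cases)
      case (left b x)
      from left(2) show ?thesis
      proof (cases rule: factors_odd_cases)
        case (even g c)
        then obtain g' d where g: "g = d # g'" using assms factors_snoc_conv_Cons by blast
        then have x: "d = (\<not> b)" "x = b # mu g' @ [c]" using even by auto
        show ?thesis
        proof (cases "c = b")
          case True
          \<comment> \<open>The trailing \<open>b\<close> of \<open>x\<close> becomes a leading
            \<open>\<not> b\<close>, which completes the image of \<open>\<not> b\<close>.\<close>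
          then have "C = cls (b # mu ((\<not> b) # b # mu g'))"
            using left(1) x cls_mu_shift[of b "b # mu g'"] by simp
          then show ?thesis using A[of b "(\<not> b) # g'"] even g x True by simp
        next
          case False
          then have "c = (\<not> b)" by auto
          then show ?thesis using B[of b g'] even g x left(1) by simp
        qed
      next
        case (odd a g)
        then show ?thesis using A[of b g] left by auto
      qed
    next
      case (right b x)
      from right(2) show ?thesis
      proof (cases rule: factors_odd_cases)
        case (even g c)
        then show ?thesis using A[of b g] right by auto
      next
        case (odd a g)
        then obtain g' d where g: "g = g' @ [d]" using assms factors_Cons_conv_snoc by blast
        then have "x @ [b] = ((\<not> a) # mu g' @ [d]) @ [\<not> d]" using odd by simp
        then have x: "d = (\<not> b)" "x = (\<not> a) # mu g' @ [d]"
          by (simp_all only: append1_eq_conv) simp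
        show ?thesis
        proof (cases "a = b")
          case True
          then have "C = cls (b # mu (mu (g' @ [\<not> b])))"
            using right(1) x cls_mu_shift[of b "mu g' @ [\<not> b]"] by simp
          then show ?thesis using A[of b "g' @ [\<not> b]"] odd g x True by simp
        next
          case False
          then have "a = (\<not> b)" by auto
          then show ?thesis using B[of b g'] odd g x right(1) by simp
        qed
      qed
    qed
  qed
qed auto

text \<open>Here \<open>x\<close> has odd length and one cut image. Up to a shift it is
  \<open>mu g @ [b]\<close> with \<open>b # g @ [b]\<close> a factor (\<open>?A\<close>),
  \<open>b # mu g\<close> with \<open>(\<not> b) # g\<close> a factor whose ends differ
  (\<open>?B\<close>), or \<open>mu g @ [\<not> b]\<close> with \<open>g @ [\<not> b]\<close> a
  factor (\<open>?C\<close>).\<close>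

lemma card_classes_4_3:
  "card (classes (Suc (2 * Suc (2 * m)))) \<le>
     card (ends True (Suc (Suc m))) + card (ends False (Suc m)) + card (factors (Suc m))"
proof (rule card_le_three_images)
  let ?A = "(\<lambda>w. cls (hd w # mu (mu (tl (butlast w)) @ [hd w]))) ` ends True (Suc (Suc m))"
  let ?B = "(\<lambda>w. cls ((\<not> hd w) # mu (tl (mu w)))) ` ends False (Suc m)"
  let ?C = "(\<lambda>w. cls ((\<not> last w) # mu (butlast (mu w)))) ` factors (Suc m)"
  have A: "cls (b # mu (mu g @ [b])) \<in> ?A" if "b # g @ [b] \<in> factors (Suc (Suc m))" for b g
    using that by (intro image_eqI[of _ _ "b # g @ [b]"]) (auto simp: ends_def)
  have C: "cls (b # mu (mu g @ [\<not> b])) \<in> ?C" if "g @ [\<not> b] \<in> factors (Suc m)" for b g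
    using that by (intro image_eqI[of _ _ "g @ [\<not> b]"]) (auto simp: butlast_append)
  have B: "cls (b # mu (b # mu g)) \<in> ?B \<union> ?C" if w: "(\<not> b) # g \<in> factors (Suc m)" for b g
  proof (cases "last ((\<not> b) # g) = b")
    case True
    then show ?thesis using w by (intro UnI1 image_eqI[of _ _ "(\<not> b) # g"]) (auto simp: ends_def)
  next
    case False
    show ?thesis
    proof (cases g rule: rev_cases)
      case Nil
      then show ?thesis using C[of "[]" b] w cls_mu_shift[of b "[]"] by simp
    next
      case (snoc g' c)
      then have c: "c = (\<not> b)" using False by auto
      \<comment> \<open>As \<open>g\<close> ends in \<open>\<not> b\<close>, its image ends in
        \<open>b\<close>. Trading this \<open>b\<close> for a leading \<open>\<not> b\<close> moves
        the cut image from the front of \<open>x\<close> to its end.\<close>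
      have "cls (b # mu (b # mu g)) = cls (b # mu ((\<not> b) # b # mu g' @ [\<not> b]))"
        using cls_mu_shift[of b "b # mu g' @ [\<not> b]"] snoc c by simp
      then show ?thesis using C[of "(\<not> b) # g'" b] w snoc c by simp
    qed
  qed
  show "classes (Suc (2 * Suc (2 * m))) \<subseteq> ?A \<union> ?B \<union> ?C"
  proof
    fix C assume "C \<in> classes (Suc (2 * Suc (2 * m)))"
    then show "C \<in> ?A \<union> ?B \<union> ?C"
    proof (cases rule: classes_odd_cases)
      case (left b x)
      then have "(\<not> b) # x \<in> factors (2 * Suc m)" "Suc m \<ge> 1" by simp_all
      then show ?thesis
      proof (cases rule: factors_even_cases)
        case (even g)
        then obtain g' where "g = (\<not> b) # g'" "x = b # mu g'" by (cases g) auto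
        then show ?thesis using B[of b g'] even left(1) by simp
      next
        case (odd a g c)
        then have x: "a = b" "x = mu g @ [c]" by auto
        show ?thesis
        proof (cases "c = b")
          case True
          then show ?thesis using A[of b g] odd x left(1) by simp
        next
          case False
          then have "c = (\<not> b)" by auto
          moreover have "g @ [c] \<in> factors (Suc m)" using odd by (blast dest: factors_ConsD)
          ultimately show ?thesis using C[of g b] x left(1) by simp
        qed
      qed
    next
      case (right b x)
      then have "x @ [b] \<in> factors (2 * Suc m)" "Suc m \<ge> 1" by simp_all
      then show ?thesis
      proof (cases rule: factors_even_cases)
        case (even g)
        then obtain g' d where g: "g = g' @ [d]" by (cases g rule: rev_cases) auto
        then have "x @ [b] = (mu g' @ [d]) @ [\<not> d]" using even by simp
        then have "d = (\<not> b)" "x = mu g' @ [\<not> b]" by (simp_all only: append1_eq_conv) simp_all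
        then show ?thesis using C[of g' b] even g right(1) by simp
      next
        case (odd a g c)
        then have "x @ [b] = ((\<not> a) # mu g) @ [c]" by simp
        then have x: "c = b" "x = (\<not> a) # mu g" by (simp_all only: append1_eq_conv)
        show ?thesis
        proof (cases "a = b")
          case True
          then have "C = cls (b # mu (mu g @ [b]))"
            using right(1) x cls_mu_shift[of b "mu g"] by simp
          then show ?thesis using A[of b g] odd x True by simp
        next
          case False
          then have a: "a = (\<not> b)" by auto
          then have "(\<not> b) # g \<in> factors (Suc m)"
            using odd factors_snocD[of "a # g" c "Suc m"] by simp
          then show ?thesis using B[of b g] x a right(1) by simp
        qed
      qed
    qed
  qed
qed auto

section \<open>Short lengths and the final induction\<close>

lemma no_cube_prefix: "a # a # a # w \<notin> factors n"
proof (induction w arbitrary: n rule: rev_induct)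
  case Nil
  then show ?case using no_cube length_factors[of "[a, a, a]" n] by (auto simp: numeral_3_eq_3)
next
  case (snoc b w)
  show ?case
  proof
    assume "a # a # a # w @ [b] \<in> factors n"
    moreover obtain k where "n = Suc k" using length_factors[OF calculation] by (cases n) auto
    ultimately show False using snoc factors_snocD[of "a # a # a # w" b k] by simp
  qed
qed

lemma card_classes_3: "card (classes 3) \<le> 2"
proof -
  let ?L = "[cls [False, False, True], cls [True, True, False]]"
  have "cls w \<in> set ?L" if "w \<in> factors 3" for w
  proof -
    obtain a b c where "w = [a, b, c]" using length_factors[OF \<open>w \<in> factors 3\<close>] by (auto simp: length_3_conv)
    then show ?thesis
      using that no_cube_prefix[of a "[]" 3]
        cls_Cons[of True "[False, False]"] cls_Cons[of False "[False, True]"]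
        cls_Cons[of False "[True, True]"] cls_Cons[of True "[True, False]"]
      by (cases a; cases b; cases c) auto
  qed
  then have "classes 3 \<subseteq> set ?L" by (auto simp: classes_def)
  then have "card (classes 3) \<le> card (set ?L)" by (intro card_mono) auto
  also have "\<dots> \<le> length ?L" by (rule card_length)
  finally show ?thesis by simp
qed

text \<open>Of the six classes of binary words of length 4, the absence of cubes removes the two
  constant ones.\<close>

lemma card_classes_4: "card (classes 4) \<le> 4"
proof -
  let ?L = "[cls [False, False, True, False], cls [True, True, False, True],
             cls [False, False, True, True], cls [False, True, False, True]]"
  have "cls w \<in> set ?L" if w: "w \<in> factors 4" for w
  proof -
    obtain a b c d where abcd: "w = [a, b, c, d]" using length_factors[OF w] by (auto simp: length_4_conv)
    then have "[b, c, d] \<in> factors 3" using w factors_ConsD[of a "[b, c, d]" 3] by simp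
    then show ?thesis
      using w abcd no_cube_prefix[of a "[d]" 4] no_cube_prefix[of b "[]" 3]
        cls_Cons[of True "[False, False, False]"] cls_Cons[of False "[False, False, True]"]
        cls_Cons[of False "[False, True, False]"] cls_Cons[of False "[True, True, True]"]
        cls_Cons[of True "[True, True, False]"] cls_Cons[of True "[True, False, True]"]
        cls_Cons[of False "[False, True, True]"] cls_Cons[of False "[True, True, False]"]
        cls_Cons[of True "[True, False, False]"] cls_Cons[of True "[False, True, False]"]
      by (cases a; cases b; cases c; cases d) auto
  qed
  then have "classes 4 \<subseteq> set ?L" by (auto simp: classes_def)
  then have "card (classes 4) \<le> card (set ?L)" by (intro card_mono) auto
  also have "\<dots> \<le> length ?L" by (rule card_length)
  finally show ?thesis by simp
qed

lemma card_classes_le: "n \<ge> 3 \<Longrightarrow> card (classes n) \<le> 2 * n - 4"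
proof (induction n rule: less_induct)
  case (less n)
  \<comment> \<open>Length 4 is separate because halving leads to length 2, which has 3 classes
    while \<open>2 * 2 - 4 = 0\<close>; length 3 because \<open>m = 0\<close> would need the bound
    on \<open>factors\<close> at length 1, where it fails.\<close>
  have "n = 3 \<or> n = 4 \<or> (\<exists>m\<ge>3. n = 2 * m) \<or> (\<exists>m\<ge>1. n = Suc (2 * (2 * m)))
      \<or> (\<exists>m\<ge>1. n = Suc (2 * Suc (2 * m)))"
    using less.prems by presburger
  then consider "n = 3" | "n = 4" | m where "n = 2 * m" "m \<ge> 3"
    | m where "n = Suc (2 * (2 * m))" "m \<ge> 1" | m where "n = Suc (2 * Suc (2 * m))" "m \<ge> 1"
    by blast
  then show ?case
  proof cases
    case 1 then show ?thesis using card_classes_3 by simp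
  next
    case 2 then show ?thesis using card_classes_4 by simp
  next
    case (3 m)
    then show ?thesis
      using less.IH[of m] card_classes_even[of m] card_ends_le[of "Suc m" False] by simp
  next
    case (4 m)
    then show ?thesis
      using card_classes_4_1[of m] card_ext_le[of m True] card_ends_le[of "Suc m" True] by simp
  next
    case (5 m)
    then show ?thesis
      using card_classes_4_3[of m] card_ends_le[of "Suc (Suc m)" True]
        card_ends_le[of "Suc m" False] card_factors_le[of "Suc m"] by simp
  qed
qed

theorem theorem3:
  fixes n :: nat
  assumes "n \<ge> 3"
  shows "cyclic_complexity n \<le> 2 * n - 4"
  using cyclic_complexity_le card_classes_le[OF assms] by (rule order_trans)

end
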